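(* Suppose $b$ and $d$ are integers satisfying $-2d<b<2d$. Let $q=e^{\pi i\tau}$ with $\operatorname{Im}\tau>0$, and let $x,y$ be nonzero complex numbers. Then \begin{align*} &\left(\sum_{m,n\in\mathbf Z}(-1)^{n-m}q^{d(m+1/2)^2+b(m+1/2)(n+1/2)+d(n+1/2)^2}x^{m+1/2}y^{n+1/2}\right)^2+\left(\sum_{m,n\in\mathbf Z}q^{dm^2+bmn+dn^2}x^my^n\right)^2\\ &=\left(\sum_{m,n\in\mathbf Z}(-1)^{n-m}q^{dm^2+bmn+dn^2}x^my^n\right)^2+\left(\sum_{m,n\in\mathbf Z}q^{d(m+1/2)^2+b(m+1/2)(n+1/2)+d(n+1/2)^2}x^{m+1/2}y^{n+1/2}\right)^2. \end{align*}
   Context: Real powers of $q$ are $q^r=e^{\pi i r\tau}$. Square roots $x^{1/2}$ and $y^{1/2}$ are fixed once and for all, and $x^{m+1/2}=x^m x^{1/2}$, $y^{n+1/2}=y^n y^{1/2}$ for integers $m,n$. *)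

theory Defs
  imports "HOL-Analysis.Analysis"
begin

text \<open>The real power \<open>q\<^sup>r\<close> of \<open>q = exp (\<pi> i \<tau>)\<close>. It is defined through \<open>\<tau>\<close> rather than as
  \<open>q powr r\<close>, because the principal branch depends only on \<open>q\<close> and disagrees with
  \<open>exp (\<pi> i r \<tau>)\<close> unless \<open>Re \<tau>\<close> lies in the appropriate range.\<close>

definition qpow :: "complex \<Rightarrow> real \<Rightarrow> complex" where
  "qpow \<tau> r = exp (complex_of_real pi * \<i> * complex_of_real r * \<tau>)"

text \<open>\<open>half_powi s x m\<close> is \<open>x\<^bsup>m+1/2\<^esup> = x\<^sup>m x\<^bsup>1/2\<^esup>\<close>, where \<open>s\<close> is the fixed square root \<open>x\<^bsup>1/2\<^esup>\<close>.\<close>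

definition half_powi :: "complex \<Rightarrow> complex \<Rightarrow> int \<Rightarrow> complex" where
  "half_powi s x m = x powi m * s"

end

theory Submission
  imports Defs
begin

text \<open>Subtracting the two alternating squares from the two plain ones, the claim says that the sum
  of the products of two terms of opposite sign is the same for the integral and for the
  half-integral lattice. Write \<open>Q\<close> for the form \<open>d m\<^sup>2 + b m n + d n\<^sup>2\<close>. For lattice points \<open>u\<close>, \<open>v\<close> we
  have \<open>Q u + Q v = (Q (u + v) + Q (u - v)) / 2\<close>, and \<open>Q\<close> is symmetric in its two arguments, so
  keeping \<open>u + v\<close> and swapping the two coordinates of \<open>u - v\<close> does not change the product of the
  terms at \<open>u\<close> and \<open>v\<close>. On pairs of opposite sign this involution exchanges integral and
  half-integral points.\<close>

section \<open>Products and squares of absolutely convergent complex series\<close>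

text \<open>Summability in \<open>complex\<close> is absolute, so the norms, which factor, can be
  summed row by row.\<close>

lemma summable_on_product_complex:
  fixes f :: "'a \<Rightarrow> complex" and g :: "'b \<Rightarrow> complex"
  assumes "f summable_on A" and "g summable_on B"
  shows "(\<lambda>(x, y). f x * g y) summable_on A \<times> B"
proof -
  have f: "(\<lambda>x. norm (f x)) summable_on A" and g: "(\<lambda>y. norm (g y)) summable_on B"
    using assms by (auto simp: summable_on_iff_abs_summable_on_complex)
  have "(\<lambda>z. norm (case z of (x, y) \<Rightarrow> f x * g y)) summable_on A \<times> B"
  proof (rule summable_on_SigmaI)
    fix x
    show "((\<lambda>y. norm (case (x, y) of (x, y) \<Rightarrow> f x * g y)) has_sum
        (norm (f x) * (\<Sum>\<^sub>\<infinity>y\<in>B. norm (g y)))) B"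
      using has_sum_cmult_right[OF has_sum_infsum[OF g], of "norm (f x)"] by (simp add: norm_mult)
  qed (use f in \<open>auto intro: summable_on_cmult_left\<close>)
  then show ?thesis
    by (rule abs_summable_summable)
qed

lemma infsum_mult_infsum_complex:
  fixes f :: "'a \<Rightarrow> complex" and g :: "'b \<Rightarrow> complex"
  assumes "f summable_on A" and "g summable_on B"
  shows "infsum f A * infsum g B = (\<Sum>\<^sub>\<infinity>(x, y)\<in>A \<times> B. f x * g y)"
proof -
  have "(\<Sum>\<^sub>\<infinity>(x, y)\<in>A \<times> B. f x * g y) = (\<Sum>\<^sub>\<infinity>x\<in>A. \<Sum>\<^sub>\<infinity>y\<in>B. f x * g y)"
    using infsum_Sigma'_banach[OF summable_on_product_complex[OF assms]] by simp
  then show ?thesis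
    by (simp add: infsum_cmult_right' infsum_cmult_left')
qed

text \<open>Expanding both squares over \<open>A \<times> A\<close> leaves the terms
  \<open>(1 - s x * s y) * f x * f y\<close>: they vanish where the signs agree and double where
  they differ.\<close>

lemma infsum_square_diff_signed:
  fixes f s :: "'a \<Rightarrow> complex"
  assumes f: "f summable_on A" and s: "\<And>x. s x = 1 \<or> s x = -1"
  shows "(infsum f A)\<^sup>2 - (\<Sum>\<^sub>\<infinity>x\<in>A. s x * f x)\<^sup>2
    = 2 * (\<Sum>\<^sub>\<infinity>(x, y)\<in>{(x, y) \<in> A \<times> A. s x * s y = -1}. f x * f y)"
proof -
  have [simp]: "norm (s x) = 1" for x
    using s[of x] by auto
  have sf: "(\<lambda>x. s x * f x) summable_on A"
    using f by (simp add: summable_on_iff_abs_summable_on_complex norm_mult)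
  have "(infsum f A)\<^sup>2 - (\<Sum>\<^sub>\<infinity>x\<in>A. s x * f x)\<^sup>2
      = (\<Sum>\<^sub>\<infinity>(x, y)\<in>A \<times> A. f x * f y) - (\<Sum>\<^sub>\<infinity>(x, y)\<in>A \<times> A. (s x * f x) * (s y * f y))"
    by (simp add: power2_eq_square infsum_mult_infsum_complex f sf)
  also have "\<dots> = (\<Sum>\<^sub>\<infinity>z\<in>A \<times> A. (case z of (x, y) \<Rightarrow> f x * f y)
      - (case z of (x, y) \<Rightarrow> (s x * f x) * (s y * f y)))"
    using summable_on_product_complex[OF f f] summable_on_product_complex[OF sf sf]
    by (simp add: infsum_add infsum_uminus summable_on_uminus flip: add_uminus_conv_diff)
  also have "\<dots> = (\<Sum>\<^sub>\<infinity>z\<in>{(x, y) \<in> A \<times> A. s x * s y = -1}.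
      2 * (case z of (x, y) \<Rightarrow> f x * f y))"
  proof (rule infsum_cong_neutral)
    fix z assume "z \<in> (A \<times> A) - {(x, y) \<in> A \<times> A. s x * s y = -1}"
    then show "(case z of (x, y) \<Rightarrow> f x * f y) - (case z of (x, y) \<Rightarrow> s x * f x * (s y * f y)) = 0"
      using s[of "fst z"] s[of "snd z"] by auto
  next
    fix z assume "z \<in> (A \<times> A) \<inter> {(x, y) \<in> A \<times> A. s x * s y = -1}"
    then show "(case z of (x, y) \<Rightarrow> f x * f y) - (case z of (x, y) \<Rightarrow> s x * f x * (s y * f y))
        = 2 * (case z of (x, y) \<Rightarrow> f x * f y)"
      using s[of "fst z"] s[of "snd z"] by auto
  qed auto
  finally show ?thesis
    by (simp add: infsum_cmult_right')
qed

section \<open>Convergence of the theta series\<close>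

lemma summable_on_exp_neg_abs: "(\<lambda>k::int. exp (- \<bar>of_int k\<bar>) :: real) summable_on UNIV"
proof -
  have nat: "(\<lambda>n::nat. exp (- real n)) summable_on UNIV"
    using summable_geometric[of "exp (-1) :: real"]
    by (intro norm_summable_imp_summable_on) (simp flip: exp_of_nat_mult)
  have "(\<lambda>k::int. exp (- \<bar>of_int k\<bar>) :: real) summable_on range int"
    using nat by (subst summable_on_reindex) (auto simp: o_def inj_on_def)
  moreover have "(\<lambda>k::int. exp (- \<bar>of_int k\<bar>) :: real) summable_on range (\<lambda>n. - int n)"
    using nat by (subst summable_on_reindex) (auto simp: o_def inj_on_def)
  \<comment> \<open>The two ranges share 0, which is harmless: summability on a union does not
    require disjointness.\<close>
  moreover have "(UNIV :: int set) = range int \<union> range (\<lambda>n. - int n)"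
    by (auto intro: int_cases2)
  ultimately show ?thesis
    by (metis summable_on_union)
qed

text \<open>The quadratic exponent outweighs the linear growth of \<open>k * ln r\<close>, with
  enough to spare for a comparison with \<open>exp (- |k|)\<close>.\<close>

lemma summable_on_gaussian_powi:
  fixes c e r :: real
  assumes "c > 0" and "r > 0"
  shows "(\<lambda>k::int. exp (- c * (of_int k + e)\<^sup>2) * r powi k) summable_on UNIV"
proof -
  \<comment> \<open>\<open>M\<close> is the growth rate of \<open>r powi k\<close> plus 1, the
    surplus that leaves \<open>exp (- |k|)\<close>. In \<open>C\<close>, the first summand is the
    maximum of \<open>M * t - c * t^2\<close> over \<open>t\<close>, and the second pays for
    replacing \<open>|k|\<close> by \<open>|k + e|\<close>.\<close>
  define M where "M = \<bar>ln r\<bar> + 1"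
  define C where "C = M\<^sup>2 / (4 * c) + M * \<bar>e\<bar>"
  have "exp (- c * (of_int k + e)\<^sup>2) * r powi k \<le> exp C * exp (- \<bar>of_int k\<bar>)" for k :: int
  proof -
    have "of_int k * ln r \<le> \<bar>of_int k\<bar> * \<bar>ln r\<bar>"
      by (metis abs_ge_self abs_mult)
    then have "of_int k * ln r + \<bar>of_int k\<bar> \<le> M * \<bar>of_int k\<bar>"
      by (simp add: M_def algebra_simps)
    also have "\<dots> \<le> M * (\<bar>of_int k + e\<bar> + \<bar>e\<bar>)"
      by (intro mult_left_mono) (auto simp: M_def)
    also have "\<dots> \<le> c * (of_int k + e)\<^sup>2 + C"
    proof -
      have "0 \<le> (2 * c * \<bar>of_int k + e\<bar> - M)\<^sup>2 / (4 * c)"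
        using assms by simp
      also have "\<dots> = c * \<bar>of_int k + e\<bar>\<^sup>2 - M * \<bar>of_int k + e\<bar> + M\<^sup>2 / (4 * c)"
        using assms by (simp add: power2_eq_square field_simps)
      finally show ?thesis
        by (simp add: C_def algebra_simps)
    qed
    finally have "- c * (of_int k + e)\<^sup>2 + of_int k * ln r \<le> C + - \<bar>of_int k\<bar>"
      by linarith
    moreover have "r powi k = exp (of_int k * ln r)"
      using assms powr_real_of_int'[of r k] by (simp add: powr_def)
    ultimately show ?thesis
      by (simp flip: exp_add)
  qed
  then show ?thesis
    using assms
    by (intro summable_on_comparison_test[OF
          summable_on_cmult_right[OF summable_on_exp_neg_abs, of "exp C"]]) auto
qed

lemma norm_qpow: "norm (qpow \<tau> r) = exp (- pi * Im \<tau> * r)"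
  by (simp add: qpow_def algebra_simps)

lemma qpow_add: "qpow \<tau> (r + s) = qpow \<tau> r * qpow \<tau> s"
  by (simp add: qpow_def algebra_simps flip: exp_add)

text \<open>The shift \<open>e\<close> is 0 for the integral and 1/2 for the half-integral lattice,
  so that one convergence proof serves both.\<close>

definition shifted_form :: "int \<Rightarrow> int \<Rightarrow> real \<Rightarrow> int \<Rightarrow> int \<Rightarrow> real" where
  "shifted_form d b e m n = of_int d * (of_int m + e)\<^sup>2
     + of_int b * (of_int m + e) * (of_int n + e) + of_int d * (of_int n + e)\<^sup>2"

text \<open>As \<open>2 * |u * v| \<le> u^2 + v^2\<close>, the mixed term costs at most
  \<open>|b| / 2\<close> times the sum of squares. The resulting constant is the smaller eigenvalue
  of the form, positive when \<open>- 2 * d < b < 2 * d\<close>.\<close>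

lemma shifted_form_ge:
  "(of_int d - \<bar>of_int b\<bar> / 2) * ((of_int m + e)\<^sup>2 + (of_int n + e)\<^sup>2) \<le> shifted_form d b e m n"
proof -
  define u v where "u = of_int m + e" and "v = of_int n + e"
  have "2 * \<bar>u * v\<bar> \<le> u\<^sup>2 + v\<^sup>2"
    using sum_squares_bound[of "\<bar>u\<bar>" "\<bar>v\<bar>"] by (simp add: abs_mult)
  then have "\<bar>of_int b\<bar> * (2 * \<bar>u * v\<bar>) \<le> \<bar>of_int b\<bar> * (u\<^sup>2 + v\<^sup>2)"
    by (rule mult_left_mono) simp
  moreover have "- (of_int b * (u * v)) \<le> \<bar>of_int b\<bar> * \<bar>u * v\<bar>"
    by (metis abs_ge_minus_self abs_mult)
  ultimately show ?thesis
    unfolding shifted_form_def u_def[symmetric] v_def[symmetric] by (simp add: algebra_simps)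
qed

text \<open>The lower bound on the form separates the variables: each term is dominated by a product
  of two one-dimensional Gaussian terms.\<close>

lemma summable_on_theta_term:
  fixes b d :: int and \<tau> x y :: complex
  assumes "- 2 * d < b" "b < 2 * d" "Im \<tau> > 0" "x \<noteq> 0" "y \<noteq> 0"
  shows "(\<lambda>(m, n). qpow \<tau> (shifted_form d b e m n) * x powi m * y powi n) summable_on UNIV"
proof -
  define c where "c = pi * Im \<tau> * (of_int d - \<bar>of_int b\<bar> / 2)"
  have "\<bar>b\<bar> < 2 * d"
    using assms by linarith
  then have "\<bar>real_of_int b\<bar> < 2 * real_of_int d"
    by linarith
  then have c: "c > 0"
    using assms by (simp add: c_def)
  define g where "g r k = exp (- c * (of_int k + e)\<^sup>2) * r powi k" for r :: real and k :: int
  have g: "(\<lambda>k. complex_of_real (g r k)) summable_on UNIV" if "r > 0" for r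
    unfolding g_def using summable_on_of_real[OF summable_on_gaussian_powi[OF c that]] by blast
  have "(\<lambda>(m, n). complex_of_real (g (norm x) m) * complex_of_real (g (norm y) n))
      summable_on UNIV \<times> UNIV"
    using assms by (intro summable_on_product_complex g) auto
  then have *: "(\<lambda>z. norm (case z of (m, n) \<Rightarrow>
      complex_of_real (g (norm x) m) * complex_of_real (g (norm y) n))) summable_on UNIV"
    by (simp add: summable_on_iff_abs_summable_on_complex)
  have bound: "norm (qpow \<tau> (shifted_form d b e m n) * x powi m * y powi n)
      \<le> norm (complex_of_real (g (norm x) m) * complex_of_real (g (norm y) n))" for m n
  proof -
    have "pi * Im \<tau> * ((of_int d - \<bar>of_int b\<bar> / 2) * ((of_int m + e)\<^sup>2 + (of_int n + e)\<^sup>2))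
        \<le> pi * Im \<tau> * shifted_form d b e m n"
      using assms by (intro mult_left_mono shifted_form_ge) auto
    then have "exp (- pi * Im \<tau> * shifted_form d b e m n)
        \<le> exp (- c * (of_int m + e)\<^sup>2 + - c * (of_int n + e)\<^sup>2)"
      by (simp add: c_def algebra_simps)
    then have "exp (- pi * Im \<tau> * shifted_form d b e m n) * (norm x powi m * norm y powi n)
        \<le> exp (- c * (of_int m + e)\<^sup>2 + - c * (of_int n + e)\<^sup>2)
          * (norm x powi m * norm y powi n)"
      by (intro mult_right_mono) auto
    also have "\<dots> = g (norm x) m * g (norm y) n"
      unfolding g_def exp_add by (simp only: mult_ac)
    also have "\<dots> \<le> \<bar>g (norm x) m\<bar> * \<bar>g (norm y) n\<bar>"
      by (metis abs_ge_self abs_mult)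
    finally show ?thesis
      by (simp add: norm_mult norm_qpow norm_power_int mult.assoc)
  qed
  show ?thesis
    by (rule abs_summable_summable, rule Infinite_Sum.abs_summable_on_comparison_test[OF *]) (use bound in auto)
qed

section \<open>A bijection between pairs of integral and pairs of half-integral points\<close>

text \<open>The half-integral point \<open>(m + 1/2, n + 1/2)\<close> is represented by \<open>(m, n)\<close>, which explains the
  offsets \<open>- 1\<close> and \<open>+ 1\<close> in the two maps below.\<close>

definition to_half :: "(int \<times> int) \<times> (int \<times> int) \<Rightarrow> (int \<times> int) \<times> (int \<times> int)" where
  "to_half = (\<lambda>((m, n), (m', n')).
     (((m + m' + n - n' - 1) div 2, (n + n' + m - m' - 1) div 2),
      ((m + m' - n + n' - 1) div 2, (n + n' - m + m' - 1) div 2)))"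

definition from_half :: "(int \<times> int) \<times> (int \<times> int) \<Rightarrow> (int \<times> int) \<times> (int \<times> int)" where
  "from_half = (\<lambda>((m, n), (m', n')).
     (((m + m' + n - n' + 1) div 2, (n + n' + m - m' + 1) div 2),
      ((m + m' - n + n' + 1) div 2, (n + n' - m + m' + 1) div 2)))"

text \<open>The product of the two signs is determined by the parity of
  \<open>n - m + n' - m'\<close>, which is that of the sum of all four coordinates.\<close>

definition opposite_sign :: "((int \<times> int) \<times> (int \<times> int)) set" where
  "opposite_sign = {((m, n), (m', n')). odd (m + n + m' + n')}"

text \<open>Before the offset, all four numerators have the parity of
  \<open>m + n + m' + n'\<close>. On \<open>opposite_sign\<close> the divisions are therefore exact,
  and \<open>div\<close> can be traded for linear equations.\<close>

lemma to_half_cases: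
  assumes "p \<in> opposite_sign"
  obtains m n m' n' i j i' j' where "p = ((m, n), (m', n'))" "to_half p = ((i, j), (i', j'))"
    "m + m' + n - n' = 2 * i + 1" "n + n' + m - m' = 2 * j + 1"
    "m + m' - n + n' = 2 * i' + 1" "n + n' - m + m' = 2 * j' + 1"
proof -
  obtain m n m' n' where p: "p = ((m, n), (m', n'))"
    by (metis prod.exhaust)
  have "odd (m + n + m' + n')"
    using assms by (auto simp: p opposite_sign_def)
  then have "odd (m + m' + n - n')" "odd (n + n' + m - m')"
    "odd (m + m' - n + n')" "odd (n + n' - m + m')"
    by auto
  then show ?thesis
    by (elim oddE) (auto intro!: that[OF p] simp: to_half_def p)
qed

lemma from_half_cases:
  assumes "p \<in> opposite_sign"
  obtains m n m' n' i j i' j' where "p = ((m, n), (m', n'))" "from_half p = ((i, j), (i', j'))"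
    "m + m' + n - n' = 2 * i - 1" "n + n' + m - m' = 2 * j - 1"
    "m + m' - n + n' = 2 * i' - 1" "n + n' - m + m' = 2 * j' - 1"
proof -
  obtain m n m' n' where p: "p = ((m, n), (m', n'))"
    by (metis prod.exhaust)
  have "odd (m + n + m' + n')"
    using assms by (auto simp: p opposite_sign_def)
  then have "even (m + m' + n - n' + 1)" "even (n + n' + m - m' + 1)"
    "even (m + m' - n + n' + 1)" "even (n + n' - m + m' + 1)"
    by auto
  then show ?thesis
    by (elim evenE) (auto intro!: that[OF p] simp: from_half_def p)
qed

text \<open>On the actual points both maps are the same linear involution; only the translation
  between points and indices reverses the offset.\<close>

lemma from_half_to_half: "p \<in> opposite_sign \<Longrightarrow> from_half (to_half p) = p"
proof (erule to_half_cases)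
  fix m n m' n' i j i' j' :: int
  assume eqs: "m + m' + n - n' = 2 * i + 1" "n + n' + m - m' = 2 * j + 1"
    "m + m' - n + n' = 2 * i' + 1" "n + n' - m + m' = 2 * j' + 1"
    and p: "p = ((m, n), (m', n'))" "to_half p = ((i, j), (i', j'))"
  have "i + i' + j - j' + 1 = 2 * m" "j + j' + i - i' + 1 = 2 * n"
    "i + i' - j + j' + 1 = 2 * m'" "j + j' - i + i' + 1 = 2 * n'"
    using eqs by linarith+
  then show ?thesis
    unfolding p(2) by (simp add: p(1) from_half_def)
qed

lemma to_half_from_half: "p \<in> opposite_sign \<Longrightarrow> to_half (from_half p) = p"
proof (erule from_half_cases)
  fix m n m' n' i j i' j' :: int
  assume eqs: "m + m' + n - n' = 2 * i - 1" "n + n' + m - m' = 2 * j - 1"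
    "m + m' - n + n' = 2 * i' - 1" "n + n' - m + m' = 2 * j' - 1"
    and p: "p = ((m, n), (m', n'))" "from_half p = ((i, j), (i', j'))"
  have "i + i' + j - j' - 1 = 2 * m" "j + j' + i - i' - 1 = 2 * n"
    "i + i' - j + j' - 1 = 2 * m'" "j + j' - i + i' - 1 = 2 * n'"
    using eqs by linarith+
  then show ?thesis
    unfolding p(2) by (simp add: p(1) to_half_def)
qed

lemma to_half_in: "p \<in> opposite_sign \<Longrightarrow> to_half p \<in> opposite_sign"
proof (frule to_half_cases)
  fix m n m' n' i j i' j' :: int
  assume eqs: "m + m' + n - n' = 2 * i + 1" "n + n' + m - m' = 2 * j + 1"
    "m + m' - n + n' = 2 * i' + 1" "n + n' - m + m' = 2 * j' + 1"
    and p: "p \<in> opposite_sign" "p = ((m, n), (m', n'))" "to_half p = ((i, j), (i', j'))"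
  \<comment> \<open>The sum of all coordinates is preserved; the four halves missing from the
    indices add up to 2, so the parity survives.\<close>
  have "m + n + m' + n' = (i + j + i' + j') + 2"
    using eqs by linarith
  moreover have "odd (m + n + m' + n')"
    using p by (simp add: opposite_sign_def)
  ultimately have "odd (i + j + i' + j')"
    by presburger
  then show ?thesis
    using p by (simp add: opposite_sign_def)
qed

lemma from_half_in: "p \<in> opposite_sign \<Longrightarrow> from_half p \<in> opposite_sign"
proof (frule from_half_cases)
  fix m n m' n' i j i' j' :: int
  assume eqs: "m + m' + n - n' = 2 * i - 1" "n + n' + m - m' = 2 * j - 1"
    "m + m' - n + n' = 2 * i' - 1" "n + n' - m + m' = 2 * j' - 1"
    and p: "p \<in> opposite_sign" "p = ((m, n), (m', n'))" "from_half p = ((i, j), (i', j'))"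
  have "i + j + i' + j' = (m + n + m' + n') + 2"
    using eqs by linarith
  moreover have "odd (m + n + m' + n')"
    using p by (simp add: opposite_sign_def)
  ultimately have "odd (i + j + i' + j')"
    by presburger
  then show ?thesis
    using p by (simp add: opposite_sign_def)
qed

section \<open>Comparison of the integral and half-integral sums\<close>

lemma minus_one_powi_product_iff:
  "(-1 :: complex) powi (n - m) * (-1) powi (n' - m') = -1 \<longleftrightarrow> odd (m + n + m' + n')"
  by (simp add: power_int_minus_left flip: power_int_add)

theorem corollary5p1:
  fixes b d :: int and \<tau> x y sqrt_x sqrt_y :: complex
  assumes "- 2 * d < b" and "b < 2 * d"
    and "Im \<tau> > 0"
    and "x \<noteq> 0" and "y \<noteq> 0"
    and "sqrt_x ^ 2 = x" and "sqrt_y ^ 2 = y"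
  shows
    "(\<Sum>\<^sub>\<infinity>(m::int, n::int)\<in>UNIV. (-1) powi (n - m)
        * qpow \<tau> (of_int d * (of_int m + 1/2)^2 + of_int b * (of_int m + 1/2) * (of_int n + 1/2)
                  + of_int d * (of_int n + 1/2)^2)
        * half_powi sqrt_x x m * half_powi sqrt_y y n) ^ 2
     + (\<Sum>\<^sub>\<infinity>(m::int, n::int)\<in>UNIV.
          qpow \<tau> (of_int (d * m^2 + b * m * n + d * n^2)) * x powi m * y powi n) ^ 2
     = (\<Sum>\<^sub>\<infinity>(m::int, n::int)\<in>UNIV. (-1) powi (n - m)
          * qpow \<tau> (of_int (d * m^2 + b * m * n + d * n^2)) * x powi m * y powi n) ^ 2
     + (\<Sum>\<^sub>\<infinity>(m::int, n::int)\<in>UNIV.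
          qpow \<tau> (of_int d * (of_int m + 1/2)^2 + of_int b * (of_int m + 1/2) * (of_int n + 1/2)
                  + of_int d * (of_int n + 1/2)^2)
          * half_powi sqrt_x x m * half_powi sqrt_y y n) ^ 2"
proof -
  \<comment> \<open>Adding 1/2 to both coordinates does not change \<open>n - m\<close>, so one sign
    function serves both lattices.\<close>
  define s :: "int \<times> int \<Rightarrow> complex" where "s = (\<lambda>(m, n). (-1) powi (n - m))"
  define F where "F = (\<lambda>(m, n). qpow \<tau> (shifted_form d b 0 m n) * x powi m * y powi n)"
  define G where "G = (\<lambda>(m, n). qpow \<tau> (shifted_form d b (1/2) m n)
    * half_powi sqrt_x x m * half_powi sqrt_y y n)"
  have s: "s p = 1 \<or> s p = -1" for p
    by (auto simp: s_def power_int_minus_left split: prod.split)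
  have F: "F summable_on UNIV"
    unfolding F_def using assms by (intro summable_on_theta_term) auto
  \<comment> \<open>The half powers contribute only a constant factor to the integral ones.\<close>
  have "G = (\<lambda>p. (case p of (m, n) \<Rightarrow> qpow \<tau> (shifted_form d b (1/2) m n) * x powi m * y powi n)
      * (sqrt_x * sqrt_y))"
    by (auto simp: G_def half_powi_def fun_eq_iff)
  then have G: "G summable_on UNIV"
    using assms by (auto intro!: summable_on_cmult_left summable_on_theta_term)
  have opp: "{p. s (fst p) * s (snd p) = -1} = opposite_sign"
    by (simp only: opposite_sign_def s_def minus_one_powi_product_iff case_prod_unfold)
  have FG: "G (fst (to_half p)) * G (snd (to_half p)) = F (fst p) * F (snd p)"
    if "p \<in> opposite_sign" for p
    using that
  proof (cases rule: to_half_cases)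
    case (1 m n m' n' i j i' j')
    \<comment> \<open>The sum of the two points is kept; the 1 comes from the two halves.\<close>
    have i: "i + i' + 1 = m + m'" and j: "j + j' + 1 = n + n'"
      using 1 by linarith+
    have "real_of_int m + m' + n - n' = 2 * i + 1" "real_of_int n + n' + m - m' = 2 * j + 1"
      "real_of_int m + m' - n + n' = 2 * i' + 1" "real_of_int n + n' - m + m' = 2 * j' + 1"
      using 1 by linarith+
    then have half: "real_of_int i + 1/2 = (m + m' + n - n') / 2"
      "real_of_int j + 1/2 = (n + n' + m - m') / 2"
      "real_of_int i' + 1/2 = (m + m' - n + n') / 2"
      "real_of_int j' + 1/2 = (n + n' - m + m') / 2"
      by auto
    \<comment> \<open>This is the parallelogram law, combined with the symmetry of the form under
      swapping the coordinates of the difference.\<close>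
    have q: "shifted_form d b (1/2) i j + shifted_form d b (1/2) i' j'
        = shifted_form d b 0 m n + shifted_form d b 0 m' n'"
      unfolding shifted_form_def half by (simp add: power2_eq_square field_simps)
    have hx: "half_powi sqrt_x x i * half_powi sqrt_x x i' = x powi m * x powi m'"
    proof -
      \<comment> \<open>The two factors \<open>sqrt_x\<close> multiply to \<open>x\<close> and
        account for the extra 1 in the exponent.\<close>
      have "half_powi sqrt_x x i * half_powi sqrt_x x i' = x powi (i + i' + 1)"
        using assms by (simp add: half_powi_def power_int_add power2_eq_square mult_ac)
      then show ?thesis
        using assms by (simp add: i power_int_add)
    qed
    have hy: "half_powi sqrt_y y j * half_powi sqrt_y y j' = y powi n * y powi n'"
    proof -
      have "half_powi sqrt_y y j * half_powi sqrt_y y j' = y powi (j + j' + 1)"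
        using assms by (simp add: half_powi_def power_int_add power2_eq_square mult_ac)
      then show ?thesis
        using assms by (simp add: j power_int_add)
    qed
    have "G (i, j) * G (i', j')
        = qpow \<tau> (shifted_form d b (1/2) i j + shifted_form d b (1/2) i' j')
          * (half_powi sqrt_x x i * half_powi sqrt_x x i')
          * (half_powi sqrt_y y j * half_powi sqrt_y y j')"
      by (simp add: G_def qpow_add)
    also have "\<dots> = F (m, n) * F (m', n')"
      unfolding q hx hy by (simp add: F_def qpow_add)
    finally show ?thesis
      using 1 by simp
  qed
  have "(infsum F UNIV)\<^sup>2 - (\<Sum>\<^sub>\<infinity>p. s p * F p)\<^sup>2
      = 2 * (\<Sum>\<^sub>\<infinity>p\<in>opposite_sign. F (fst p) * F (snd p))"
    using infsum_square_diff_signed[of F UNIV s] F s by (simp add: opp case_prod_unfold)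
  also have "(\<Sum>\<^sub>\<infinity>p\<in>opposite_sign. F (fst p) * F (snd p))
      = (\<Sum>\<^sub>\<infinity>p\<in>opposite_sign. G (fst p) * G (snd p))"
    by (rule infsum_reindex_bij_witness[of _ from_half to_half])
      (auto simp: from_half_to_half to_half_from_half to_half_in from_half_in FG)
  also have "2 * \<dots> = (infsum G UNIV)\<^sup>2 - (\<Sum>\<^sub>\<infinity>p. s p * G p)\<^sup>2"
    using infsum_square_diff_signed[of G UNIV s] G s by (simp add: opp case_prod_unfold)
  finally have "(\<Sum>\<^sub>\<infinity>p. s p * G p)\<^sup>2 + (infsum F UNIV)\<^sup>2
      = (\<Sum>\<^sub>\<infinity>p. s p * F p)\<^sup>2 + (infsum G UNIV)\<^sup>2"
    by (simp add: algebra_simps)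
  \<comment> \<open>The exponents in the claim are \<open>shifted_form\<close> at shifts 0 and
    1/2.\<close>
  then show ?thesis
    by (simp add: F_def G_def s_def shifted_form_def case_prod_unfold mult.assoc)
qed

end
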